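(* Let $n_1,n_2,n_3\ge 2$, $r\le\min\{n_1,n_2\}$, $b,c>0$, and let $\mathcal{X}^*=\mathcal{A}^*\diamond\mathcal{B}^*\in\mathbb{R}_+^{n_1\times n_2\times n_3}$ with $\mathcal{A}^*\in\mathbb{R}_+^{n_1\times r\times n_3}$, $\mathcal{B}^*\in\mathbb{R}_+^{r\times n_2\times n_3}$, $0\le\mathcal{X}^*_{ijk}\le c/2$, $0\le\mathcal{A}^*_{ijk}\le 1$, $0\le\mathcal{B}^*_{ijk}\le b$. Let $4\le m\le n_1n_2n_3$, $\gamma=\frac{m}{n_1n_2n_3}$, and let $\Omega\sim\mathrm{Bern}(\gamma)$; given $\Omega$, let the observations $\mathcal{Y}_\Omega$ have joint density/mass function $p_{\mathcal{X}^*_\Omega}(\mathcal{Y}_\Omega)=\prod_{(i,j,k)\in\Omega}p_{\mathcal{X}^*_{ijk}}(\mathcal{Y}_{ijk})$. Fix $\beta\ge 3$ and let $\Gamma$ and $\widetilde{\mathcal{X}}^\lambda$ be as in the context. Suppose $\kappa\ge\max_{\mathcal{X}\in\Gamma}\max_{i,j,k}D(p_{\mathcal{X}^*_{ijk}}\|p_{\mathcal{X}_{ijk}})$. Then for any $\lambda\ge 4(\beta+2)\left(1+\frac{2\kappa}{3}\right)\log\left((n_1\vee n_2)\sqrt{n_3}\right)$, the estimator $\widetilde{\mathcal{X}}^\lambda$ satisfies \[ \frac{\mathbb{E}_{\Omega,\mathcal{Y}_\Omega}[-2\log H(p_{\widetilde{\mathcal{X}}^\lambda},p_{\mathcal{X}^*})]}{n_1n_2n_3}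 \le 3\min_{\mathcal{X}=\mathcal{A}\diamond\mathcal{B}\in\Gamma}\left\{\frac{D(p_{\mathcal{X}^*}\|p_{\mathcal{X}})}{n_1n_2n_3}+\left(\lambda+\frac{8\kappa(\beta+2)\log((n_1\vee n_2)\sqrt{n_3})}{3}\right)\frac{rn_1n_3+\|\mathcal{B}\|_0}{m}\right\}+\frac{8\kappa\log(m)}{m}. \]
   Context: Tensor-tensor product: for $\mathcal{X}\in\mathbb{R}^{n_1\times n_2\times n_3}$ with frontal slices $\mathbf{X}^{(1)},\dots,\mathbf{X}^{(n_3)}$ and $\mathcal{Y}\in\mathbb{R}^{n_2\times n_4\times n_3}$, $\mathcal{X}\diamond\mathcal{Y}\in\mathbb{R}^{n_1\times n_4\times n_3}$ is obtained by multiplying the block-circulant matrix whose $(p,q)$ block is $\mathbf{X}^{((p-q)\bmod n_3+1)}$ by the vertical stack of the frontal slices of $\mathcal{Y}$, and folding the resulting $n_1n_3\times n_4$ block column back into frontal slices. $\|\mathcal{B}\|_0$ is the number of nonzero entries; $m\vee n=\max\{m,n\}$. $\Omega\sim\mathrm{Bern}(\gamma)$ means each index $(i,j,k)$ belongs to $\Omega$ independently with probability $\gamma$. $\{p_x\}$ is a scalar parametric family of densities or mass functions; $D(p\|q)=\mathbb{E}_p[\log(p/q)]$ (KL divergence), $H(p,q)=\mathbb{E}_p[\sqrt{q/p}]$ (Hellinger affinity); for tensors, $D(p_{\mathcal{X}_1}\|p_{\mathcal{X}_2})=\sum_{i,j,k}D(p_{(\mathcal{X}_1)_{ijk}}\|p_{(\mathcal{X}_2)_{ijk}})$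 and $H(p_{\mathcal{X}_1},p_{\mathcal{X}_2})=\prod_{i,j,k}H(p_{(\mathcal{X}_1)_{ijk}},p_{(\mathcal{X}_2)_{ijk}})$. Let $\vartheta=2^{\lceil\beta\log_2(n_1\vee n_2)\rceil}$. $\mathfrak{L}$ is the set of tensors in $\mathbb{R}_+^{n_1\times r\times n_3}$ each of whose entries is one of $\vartheta$ uniformly spaced discretization levels of $[0,1]$; $\mathfrak{D}$ is the set of tensors in $\mathbb{R}_+^{r\times n_2\times n_3}$ each of whose entries is either $0$ or one of $\vartheta$ uniformly spaced discretization levels of $[0,b]$. $\Gamma=\{\mathcal{X}=\mathcal{A}\diamond\mathcal{B}:\mathcal{A}\in\mathfrak{L},\mathcal{B}\in\mathfrak{D},0\le\mathcal{X}_{ijk}\le c\ \forall i,j,k\}$. The estimator is $\widetilde{\mathcal{X}}^\lambda\in\arg\min_{\mathcal{X}=\mathcal{A}\diamond\mathcal{B}\in\Gamma}\{-\log p_{\mathcal{X}_\Omega}(\mathcal{Y}_\Omega)+\lambda\|\mathcal{B}\|_0\}$, where $p_{\mathcal{X}_\Omega}(\mathcal{Y}_\Omega)=\prod_{(i,j,k)\in\Omega}p_{\mathcal{X}_{ijk}}(\mathcal{Y}_{ijk})$. *)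

theory Defs
  imports "HOL-Probability.Probability"
begin

type_synonym idx = "nat \<times> nat \<times> nat"
type_synonym tensor = "idx \<Rightarrow> real"

definition box :: "nat \<Rightarrow> nat \<Rightarrow> nat \<Rightarrow> idx set" where
  "box n1 n2 n3 = {0..<n1} \<times> {0..<n2} \<times> {0..<n3}"

text \<open>Tensor-tensor product of an n1 x k x n3 tensor with a k x n4 x n3 tensor:
  frontal slice q of the result is the sum over s of X-slice ((q - s) mod n3) times Y-slice s
  (block-circulant matrix times stacked slices, folded back).\<close>
definition tprod :: "nat \<Rightarrow> nat \<Rightarrow> tensor \<Rightarrow> tensor \<Rightarrow> tensor" where
  "tprod k n3 X Y = (\<lambda>(i, l, q). \<Sum>s<n3. \<Sum>j<k. X (i, j, (q + n3 - s) mod n3) * Y (j, l, s))"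

definition l0 :: "nat \<Rightarrow> nat \<Rightarrow> nat \<Rightarrow> tensor \<Rightarrow> nat" where
  "l0 n1 n2 n3 B = card {t \<in> box n1 n2 n3. B t \<noteq> 0}"

definition theta :: "real \<Rightarrow> nat \<Rightarrow> nat \<Rightarrow> nat" where
  "theta \<beta> n1 n2 = 2 ^ nat \<lceil>\<beta> * log 2 (real (max n1 n2))\<rceil>"

definition levels :: "nat \<Rightarrow> real \<Rightarrow> real set" where
  "levels th a = {a * real k / real (th - 1) | k. k < th}"

definition frakL :: "nat \<Rightarrow> nat \<Rightarrow> nat \<Rightarrow> nat \<Rightarrow> tensor set" where
  "frakL n1 r n3 th = {A. (\<forall>t\<in>box n1 r n3. A t \<in> levels th 1) \<and> (\<forall>t. t \<notin> box n1 r n3 \<longrightarrow> A t = 0)}"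

definition frakD :: "nat \<Rightarrow> nat \<Rightarrow> nat \<Rightarrow> nat \<Rightarrow> real \<Rightarrow> tensor set" where
  "frakD r n2 n3 th b = {B. (\<forall>t\<in>box r n2 n3. B t = 0 \<or> B t \<in> levels th b) \<and> (\<forall>t. t \<notin> box r n2 n3 \<longrightarrow> B t = 0)}"

text \<open>Gamma, as the set of factor pairs (A,B) (the penalty depends on B).\<close>
definition Gamma :: "nat \<Rightarrow> nat \<Rightarrow> nat \<Rightarrow> nat \<Rightarrow> nat \<Rightarrow> real \<Rightarrow> real \<Rightarrow> (tensor \<times> tensor) set" where
  "Gamma n1 n2 n3 r th b c = {(A, B). A \<in> frakL n1 r n3 th \<and> B \<in> frakD r n2 n3 th b \<and>
      (\<forall>t\<in>box n1 n2 n3. 0 \<le> tprod r n3 A B t \<and> tprod r n3 A B t \<le> c)}"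

definition nlog :: "real \<Rightarrow> ereal" where
  "nlog v = (if v > 0 then ereal (- ln v) else \<infinity>)"

definition KL :: "'y measure \<Rightarrow> ('y \<Rightarrow> real) \<Rightarrow> ('y \<Rightarrow> real) \<Rightarrow> ereal" where
  "KL M p q = (if (AE y in density M (\<lambda>y. ennreal (p y)). q y > 0) \<and>
                  integrable (density M (\<lambda>y. ennreal (p y))) (\<lambda>y. ln (p y / q y))
               then ereal (\<integral>y. ln (p y / q y) \<partial>density M (\<lambda>y. ennreal (p y))) else \<infinity>)"

definition hell :: "'y measure \<Rightarrow> ('y \<Rightarrow> real) \<Rightarrow> ('y \<Rightarrow> real) \<Rightarrow> real" where
  "hell M p q = (\<integral>y. sqrt (q y / p y) \<partial>density M (\<lambda>y. ennreal (p y)))"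

definition KLt :: "'y measure \<Rightarrow> (real \<Rightarrow> 'y \<Rightarrow> real) \<Rightarrow> idx set \<Rightarrow> tensor \<Rightarrow> tensor \<Rightarrow> ereal" where
  "KLt M p I X1 X2 = (\<Sum>t\<in>I. KL M (p (X1 t)) (p (X2 t)))"

definition hellt :: "'y measure \<Rightarrow> (real \<Rightarrow> 'y \<Rightarrow> real) \<Rightarrow> idx set \<Rightarrow> tensor \<Rightarrow> tensor \<Rightarrow> real" where
  "hellt M p I X1 X2 = (\<Prod>t\<in>I. hell M (p (X1 t)) (p (X2 t)))"

definition objective :: "(real \<Rightarrow> 'y \<Rightarrow> real) \<Rightarrow> nat \<Rightarrow> nat \<Rightarrow> nat \<Rightarrow> real \<Rightarrow> idx set \<Rightarrow> (idx \<Rightarrow> 'y) \<Rightarrow> tensor \<times> tensor \<Rightarrow> ereal" where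
  "objective p n2 n3 r lam \<Omega> Y AB =
     nlog (\<Prod>t\<in>\<Omega>. p (tprod r n3 (fst AB) (snd AB) t) (Y t)) + ereal (lam * real (l0 r n2 n3 (snd AB)))"

end

theory Submission
  imports Defs
begin

text \<open>
  Let \<open>L\<close> be the log-likelihood ratio of the truth against a candidate on the sampled entries and
  \<open>h\<close> the sum over all entries of minus twice the logarithm of the Hellinger affinity. For
  \<open>s \<le> 1/2\<close>, Jensen's inequality in the observations and \<open>1 - exp (- u) \<ge> u / (1 + u)\<close> in the Bernoulli
  mask give \<open>E exp (- s L) \<le> exp (- s \<gamma> h / (1 + s \<kappa>))\<close>. Summing over all candidates with weights
  \<open>exp (- k)\<close> that satisfy Kraft's inequality, and using \<open>u \<le> exp u - 1\<close> at the candidate selected by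
  the estimator, bounds the expectation of \<open>\<gamma> h / (1 + s \<kappa>)\<close> by that of the penalized
  log-likelihood ratio, where \<open>k / s\<close> is at most the penalty for \<open>s = 1 / (2 + 4 \<kappa> / 3)\<close>. The
  estimator minimizes the latter, so it may be replaced by any fixed candidate. With this \<open>s\<close>,
  \<open>1 + s \<kappa> \<le> 3\<close>. No event on which the mask behaves badly is split off, so the argument
  does not produce the \<open>log m / m\<close> term.

  The estimator need not be measurable; all integrals are therefore taken of majorants which are
  finite sums over the candidates.
\<close>

lemma hell_affinity:
  fixes p q :: "'y \<Rightarrow> real"
  assumes [measurable]: "p \<in> borel_measurable M" "q \<in> borel_measurable M"
    and nn: "\<And>y. 0 \<le> p y" "\<And>y. 0 \<le> q y"
    and pp: "prob_space (density M (\<lambda>y. ennreal (p y)))"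
    and pq: "prob_space (density M (\<lambda>y. ennreal (q y)))"
  shows integrable_sqrt_ratio: "integrable (density M (\<lambda>y. ennreal (p y))) (\<lambda>y. sqrt (q y / p y))"
    and hell_commute: "hell M q p = hell M p q"
    and hell_le_1: "hell M p q \<le> 1"
proof -
  have int: "integrable M f" "(\<integral>y. f y \<partial>M) = 1"
    if [measurable]: "f \<in> borel_measurable M" and f: "\<And>y. 0 \<le> f y"
      and pf: "prob_space (density M (\<lambda>y. ennreal (f y)))" for f
  proof -
    interpret F: prob_space "density M (\<lambda>y. ennreal (f y))" by (rule pf)
    have e: "(\<integral>\<^sup>+y. ennreal (f y) \<partial>M) = 1"
      using F.emeasure_space_1 by (simp add: emeasure_density cong: nn_integral_cong)
    show "integrable M f"
      by (rule integrableI_nonneg) (use f e in auto)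
    show "(\<integral>y. f y \<partial>M) = 1"
      by (subst integral_eq_nn_integral) (use f e in auto)
  qed
  note ip = int[OF assms(1) nn(1) pp] and iq = int[OF assms(2) nn(2) pq]
  have amgm: "sqrt (p y * q y) \<le> (p y + q y) / 2" for y
    using arith_geo_mean_sqrt[OF nn(1)[of y] nn(2)[of y]] .
  have ipq: "integrable M (\<lambda>y. sqrt (p y * q y))"
    by (rule Bochner_Integration.integrable_bound[where f="\<lambda>y. (p y + q y) / 2"])
       (use ip iq nn amgm in auto)
  have red: "a * sqrt (b / a) = sqrt (a * b)" if "0 \<le> a" for a b :: real
    using that by (cases "a = 0") (auto simp: real_sqrt_mult real_sqrt_divide field_simps)
  show "integrable (density M (\<lambda>y. ennreal (p y))) (\<lambda>y. sqrt (q y / p y))"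
    by (subst integrable_density) (use nn ipq in \<open>auto simp: red\<close>)
  have h1: "hell M p q = (\<integral>y. sqrt (p y * q y) \<partial>M)"
    unfolding hell_def by (subst integral_density) (use nn in \<open>auto simp: red\<close>)
  have h2: "hell M q p = (\<integral>y. sqrt (p y * q y) \<partial>M)"
    unfolding hell_def by (subst integral_density) (use nn in \<open>auto simp: red mult.commute\<close>)
  show "hell M q p = hell M p q" using h1 h2 by simp
  have "hell M p q \<le> (\<integral>y. (p y + q y) / 2 \<partial>M)"
    unfolding h1 by (rule integral_mono) (use ipq ip iq amgm in auto)
  also have "\<dots> = 1" using ip iq by simp
  finally show "hell M p q \<le> 1" .
qed

lemma
  fixes p q :: "'y \<Rightarrow> real"
  assumes [measurable]: "p \<in> borel_measurable M" "q \<in> borel_measurable M"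
    and nn: "\<And>y. 0 \<le> p y" "\<And>y. 0 \<le> q y"
    and pp: "prob_space (density M (\<lambda>y. ennreal (p y)))"
    and pq: "prob_space (density M (\<lambda>y. ennreal (q y)))"
    and qpos: "AE y in density M (\<lambda>y. ennreal (p y)). q y > 0"
  shows hell_pos: "0 < hell M p q"
    and log_hell_le_KL: "integrable (density M (\<lambda>y. ennreal (p y))) (\<lambda>y. ln (p y / q y)) \<Longrightarrow>
           - 2 * ln (hell M p q) \<le> (\<integral>y. ln (p y / q y) \<partial>density M (\<lambda>y. ennreal (p y)))"
    and likelihood_ratio_mgf: "\<And>s. 0 < s \<Longrightarrow> s \<le> 1/2 \<Longrightarrow>
           (\<integral>\<^sup>+y. ennreal (exp (- s * ln (p y / q y))) \<partial>density M (\<lambda>y. ennreal (p y)))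
             \<le> ennreal (exp (2 * s * ln (hell M p q)))"
proof -
  let ?P = "density M (\<lambda>y. ennreal (p y))"
  interpret P: prob_space ?P by (rule pp)
  have ps: "P.prob (space M) = 1" using P.prob_space by simp
  define u where "u y = sqrt (q y / p y)" for y
  have [measurable]: "u \<in> borel_measurable M" unfolding u_def by measurable
  have u: "integrable ?P u" using integrable_sqrt_ratio[OF assms(1-6)] by (simp add: u_def[abs_def])
  have H: "hell M p q = (\<integral>y. u y \<partial>?P)" by (simp add: hell_def u_def)
  have ppos: "AE y in ?P. p y > 0" by (subst AE_density) auto
  have upos: "AE y in ?P. u y > 0" using ppos qpos by eventually_elim (simp add: u_def)
  have u0: "u y \<ge> 0" for y using nn by (simp add: u_def)
  have "hell M p q \<noteq> 0"
  proof
    assume "hell M p q = 0"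
    then have "AE y in ?P. u y = 0"
      using integral_nonneg_eq_0_iff_AE[OF u] u0 by (simp add: H)
    with upos have "AE y in ?P. False" by eventually_elim auto
    then show False by simp
  qed
  moreover have "0 \<le> hell M p q" unfolding H using u0 by simp
  ultimately show Hp: "0 < hell M p q" by simp
  have lnu: "AE y in ?P. ln (p y / q y) = - 2 * ln (u y)"
    using ppos qpos by eventually_elim (simp add: u_def ln_sqrt ln_div)
  let ?H = "hell M p q"
  show "- 2 * ln ?H \<le> (\<integral>y. ln (p y / q y) \<partial>?P)" if I: "integrable ?P (\<lambda>y. ln (p y / q y))"
  proof -
    have "(\<integral>y. - 2 * ln ?H - 2 * (u y / ?H - 1) \<partial>?P) \<le> (\<integral>y. ln (p y / q y) \<partial>?P)"
    proof (rule integral_mono_AE)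
      show "AE y in ?P. - 2 * ln ?H - 2 * (u y / ?H - 1) \<le> ln (p y / q y)"
        using lnu upos
      proof eventually_elim
        case (elim y)
        have "ln (u y / ?H) \<le> u y / ?H - 1" using elim Hp by (intro ln_le_minus_one) simp
        with elim Hp show ?case by (simp add: ln_div)
      qed
    qed (use u I in auto)
    moreover have "(\<integral>y. - 2 * ln ?H - 2 * (u y / ?H - 1) \<partial>?P) = - 2 * ln ?H"
      using u Hp by (simp add: H[symmetric] ps)
    ultimately show ?thesis by simp
  qed
  fix s :: real assume s: "0 < s" "s \<le> 1/2"
  have "(\<integral>\<^sup>+y. ennreal (exp (- s * ln (p y / q y))) \<partial>?P)
      \<le> (\<integral>\<^sup>+y. ennreal (exp (2 * s * ln ?H) * (1 - 2 * s + 2 * s * (u y / ?H))) \<partial>?P)"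
  proof (rule nn_integral_mono_AE)
    show "AE y in ?P. ennreal (exp (- s * ln (p y / q y)))
        \<le> ennreal (exp (2 * s * ln ?H) * (1 - 2 * s + 2 * s * (u y / ?H)))"
      using lnu upos
    proof eventually_elim
      case (elim y)
      have "exp ((1 - 2 * s) *\<^sub>R 0 + (2 * s) *\<^sub>R ln (u y / ?H))
           \<le> (1 - 2 * s) * exp 0 + 2 * s * exp (ln (u y / ?H))"
        by (rule convex_onD[OF exp_convex]) (use s in auto)
      then have "exp (2 * s * ln (u y / ?H)) \<le> 1 - 2 * s + 2 * s * (u y / ?H)"
        using elim Hp by simp
      then have "exp (2 * s * ln ?H) * exp (2 * s * ln (u y / ?H))
          \<le> exp (2 * s * ln ?H) * (1 - 2 * s + 2 * s * (u y / ?H))" by simp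
      moreover have "exp (2 * s * ln ?H) * exp (2 * s * ln (u y / ?H)) = exp (- s * ln (p y / q y))"
        using elim Hp by (simp add: exp_add[symmetric] ln_div algebra_simps)
      ultimately show ?case by (simp add: ennreal_leI)
    qed
  qed
  also have "\<dots> = ennreal (\<integral>y. exp (2 * s * ln ?H) * (1 - 2 * s + 2 * s * (u y / ?H)) \<partial>?P)"
    by (rule nn_integral_eq_integral) (use u s Hp u0 in auto)
  also have "(\<integral>y. exp (2 * s * ln ?H) * (1 - 2 * s + 2 * s * (u y / ?H)) \<partial>?P) = exp (2 * s * ln ?H)"
    using u Hp by (simp add: H[symmetric] ps)
  finally show "(\<integral>\<^sup>+y. ennreal (exp (- s * ln (p y / q y))) \<partial>?P) \<le> ennreal (exp (2 * s * ln ?H))" .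
qed

lemma Bernoulli_mask_exp_bound:
  fixes s \<gamma> \<kappa> h :: real
  assumes "0 < s" "0 \<le> \<gamma>" "0 \<le> h" "h \<le> \<kappa>"
  shows "1 - \<gamma> + \<gamma> * exp (- s * h) \<le> exp (- (\<gamma> * s * h / (1 + s * \<kappa>)))"
proof -
  have sh: "0 \<le> s * h" "s * h \<le> s * \<kappa>" using assms by simp_all
  have "exp (- (s * h)) \<le> 1 / (1 + s * h)"
    using exp_ge_add_one_self[of "s * h"] sh by (simp add: exp_minus field_simps)
  also have "\<dots> = 1 - s * h / (1 + s * h)" using sh by (simp add: field_simps)
  also have "\<dots> \<le> 1 - s * h / (1 + s * \<kappa>)"
    using sh by (simp add: divide_left_mono mult_nonneg_nonneg)
  finally have "\<gamma> * exp (- (s * h)) \<le> \<gamma> * (1 - s * h / (1 + s * \<kappa>))"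
    by (rule mult_left_mono) (rule assms)
  then have "1 - \<gamma> + \<gamma> * exp (- s * h) \<le> 1 + (- (\<gamma> * s * h / (1 + s * \<kappa>)))"
    by (simp add: algebra_simps)
  also have "\<dots> \<le> exp (- (\<gamma> * s * h / (1 + s * \<kappa>)))" by (rule exp_ge_add_one_self)
  finally show ?thesis .
qed

lemma
  fixes P :: "'i \<Rightarrow> 'y measure" and l :: "'i \<Rightarrow> 'y \<Rightarrow> real" and \<gamma> :: real
  assumes I: "finite I" and P: "\<And>t. prob_space (P t)" and \<gamma>: "0 \<le> \<gamma>" "\<gamma> \<le> 1"
    and l[measurable]: "\<And>t. t \<in> I \<Longrightarrow> l t \<in> borel_measurable (P t)"
  defines "\<mu> \<equiv> PiM I (\<lambda>_. measure_pmf (bernoulli_pmf \<gamma>)) \<Otimes>\<^sub>M PiM I P"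
  shows integrable_masked: "t \<in> I \<Longrightarrow> integrable (P t) (l t) \<Longrightarrow>
           integrable \<mu> (\<lambda>\<omega>. if fst \<omega> t then l t (snd \<omega> t) else 0)"
    and integral_masked: "t \<in> I \<Longrightarrow> integrable (P t) (l t) \<Longrightarrow>
           (\<integral>\<omega>. (if fst \<omega> t then l t (snd \<omega> t) else 0) \<partial>\<mu>) = \<gamma> * (\<integral>y. l t y \<partial>P t)"
    and nn_integral_exp_masked:
       "(\<integral>\<^sup>+\<omega>. ennreal (exp (- s * (\<Sum>t\<in>I. if fst \<omega> t then l t (snd \<omega> t) else 0))) \<partial>\<mu>)
         = (\<Prod>t\<in>I. ennreal \<gamma> * (\<integral>\<^sup>+y. ennreal (exp (- s * l t y)) \<partial>P t) + ennreal (1 - \<gamma>))"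
proof -
  let ?B = "measure_pmf (bernoulli_pmf \<gamma>)"
  let ?M1 = "PiM I (\<lambda>_. ?B)" and ?M2 = "PiM I P"
  interpret B: product_prob_space "\<lambda>_. ?B" I
    by (intro product_prob_spaceI measure_pmf.prob_space_axioms)
  interpret Q: product_prob_space P I
    by (intro product_prob_spaceI P)
  interpret pair_prob_space ?M1 ?M2 ..
  have mB: "(\<lambda>x. x t) \<in> measurable ?M1 (count_space UNIV)" if "t \<in> I" for t
    using measurable_component_singleton[OF that, of "\<lambda>_. ?B"] by simp
  have mQ: "(\<lambda>x. l t (x t)) \<in> borel_measurable ?M2" if "t \<in> I" for t
    by (rule measurable_compose[OF measurable_component_singleton[OF that, of P] l[OF that]])
  have meas: "(\<lambda>\<omega>. if fst \<omega> t then l t (snd \<omega> t) else 0) \<in> borel_measurable \<mu>" if t: "t \<in> I" for t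
  proof -
    note [measurable] = mB[OF t] mQ[OF t]
    show ?thesis unfolding \<mu>_def by measurable
  qed
  have dB: "distr ?M1 ?B (\<lambda>x. x t) = ?B" if "t \<in> I" for t by (rule B.PiM_component[OF that])
  have dQ: "distr ?M2 (P t) (\<lambda>x. x t) = P t" if "t \<in> I" for t by (rule Q.PiM_component[OF that])
  have eB: "(\<integral>x. f (x t) \<partial>?M1) = (\<integral>x. f x \<partial>?B)" if t: "t \<in> I" for t and f :: "bool \<Rightarrow> real"
    by (subst (2) dB[OF t, symmetric], subst integral_distr) (use t in auto)
  have eQ: "(\<integral>x. f (x t) \<partial>?M2) = (\<integral>x. f x \<partial>P t)"
    if t: "t \<in> I" and "f \<in> borel_measurable (P t)" for t and f :: "'y \<Rightarrow> real"
    using integral_distr[OF measurable_component_singleton[OF t, of P] that(2)] dQ[OF t] by simp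
  have iQ: "integrable ?M2 (\<lambda>x. f (x t))"
    if t: "t \<in> I" and f: "integrable (P t) f" for t and f :: "'y \<Rightarrow> real"
  proof -
    have "integrable (distr ?M2 (P t) (\<lambda>x. x t)) f" using f dQ[OF t] by simp
    then show ?thesis using t f by (subst (asm) integrable_distr_eq) auto
  qed
  have iB: "integrable ?M1 (\<lambda>x. (if x t then a else 0))" if "t \<in> I" for t and a :: real
  proof -
    note [measurable] = mB[OF that]
    show ?thesis by (rule B.P.integrable_const_bound[where B="\<bar>a\<bar>"]) auto
  qed
  show im: "integrable \<mu> (\<lambda>\<omega>. if fst \<omega> t then l t (snd \<omega> t) else 0)"
    if t: "t \<in> I" and i: "integrable (P t) (l t)" for t
    unfolding \<mu>_def
  proof (rule Fubini_integrable)
    show "(\<lambda>\<omega>. if fst \<omega> t then l t (snd \<omega> t) else 0) \<in> borel_measurable (?M1 \<Otimes>\<^sub>M ?M2)"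
      using meas[OF t] by (simp add: \<mu>_def)
    have "integrable ?M2 (\<lambda>y. if z then l t (y t) else 0)" for z
      using iQ[OF t i] by (cases z) simp_all
    then show "AE x in ?M1. integrable ?M2 (\<lambda>y. if fst (x, y) t then l t (snd (x, y) t) else 0)"
      by (simp only: fst_conv snd_conv) simp
    have "(\<lambda>x. \<integral>y. norm (if fst (x, y) t then l t (snd (x, y) t) else 0) \<partial>?M2)
      = (\<lambda>x. if x t then (\<integral>y. norm (l t (y t)) \<partial>?M2) else 0)" by auto
    then show "integrable ?M1 (\<lambda>x. \<integral>y. norm (if fst (x, y) t then l t (snd (x, y) t) else 0) \<partial>?M2)"
      using iB[OF t] by simp
  qed
  show "(\<integral>\<omega>. (if fst \<omega> t then l t (snd \<omega> t) else 0) \<partial>\<mu>) = \<gamma> * (\<integral>y. l t y \<partial>P t)"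
    if t: "t \<in> I" and i: "integrable (P t) (l t)" for t
  proof -
    have "(\<integral>\<omega>. (if fst \<omega> t then l t (snd \<omega> t) else 0) \<partial>\<mu>)
       = (\<integral>x. (\<integral>y. (if fst (x, y) t then l t (snd (x, y) t) else 0) \<partial>?M2) \<partial>?M1)"
      using integral_fst'[OF im[OF t i, unfolded \<mu>_def]] by (simp add: \<mu>_def)
    also have "\<dots> = (\<integral>x. (if x t then (\<integral>y. l t y \<partial>P t) else 0) \<partial>?M1)"
      using eQ[OF t l[OF t]] by (intro Bochner_Integration.integral_cong) auto
    also have "\<dots> = (\<integral>x. (if x then (\<integral>y. l t y \<partial>P t) else 0) \<partial>?B)"
      by (rule eB[OF t])
    also have "\<dots> = \<gamma> * (\<integral>y. l t y \<partial>P t)" using \<gamma> by simp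
    finally show ?thesis .
  qed
  have "(\<integral>\<^sup>+\<omega>. ennreal (exp (- s * (\<Sum>t\<in>I. if fst \<omega> t then l t (snd \<omega> t) else 0))) \<partial>\<mu>)
      = (\<integral>\<^sup>+x. \<integral>\<^sup>+y. ennreal (exp (- s * (\<Sum>t\<in>I. if x t then l t (y t) else 0))) \<partial>?M2 \<partial>?M1)"
    unfolding \<mu>_def
    by (subst Q.P.nn_integral_fst[symmetric]) (use meas in \<open>simp_all add: \<mu>_def cong: if_cong\<close>)
  also have "\<dots> = (\<integral>\<^sup>+x. (\<Prod>t\<in>I. if x t then (\<integral>\<^sup>+y. ennreal (exp (- s * l t y)) \<partial>P t) else 1) \<partial>?M1)"
  proof (rule nn_integral_cong)
    fix x :: "'i \<Rightarrow> bool"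
    have "(\<integral>\<^sup>+y. ennreal (exp (- s * (\<Sum>t\<in>I. if x t then l t (y t) else 0))) \<partial>?M2)
       = (\<integral>\<^sup>+y. (\<Prod>t\<in>I. if x t then ennreal (exp (- s * l t (y t))) else 1) \<partial>?M2)"
      using I by (intro nn_integral_cong)
        (auto simp: sum_distrib_left exp_sum prod_ennreal[symmetric] intro!: prod.cong)
    also have "\<dots> = (\<Prod>t\<in>I. \<integral>\<^sup>+y. (if x t then ennreal (exp (- s * l t y)) else 1) \<partial>P t)"
      by (rule Q.product_nn_integral_prod[OF I]) auto
    also have "\<dots> = (\<Prod>t\<in>I. if x t then (\<integral>\<^sup>+y. ennreal (exp (- s * l t y)) \<partial>P t) else 1)"
      by (intro prod.cong) (auto simp: prob_space.emeasure_space_1[OF P])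
    finally show "(\<integral>\<^sup>+y. ennreal (exp (- s * (\<Sum>t\<in>I. if x t then l t (y t) else 0))) \<partial>?M2)
      = (\<Prod>t\<in>I. if x t then (\<integral>\<^sup>+y. ennreal (exp (- s * l t y)) \<partial>P t) else 1)" .
  qed
  also have "\<dots> = (\<Prod>t\<in>I. \<integral>\<^sup>+x. (if x then (\<integral>\<^sup>+y. ennreal (exp (- s * l t y)) \<partial>P t) else 1) \<partial>?B)"
    by (rule B.product_nn_integral_prod[OF I]) auto
  also have "\<dots> = (\<Prod>t\<in>I. ennreal \<gamma> * (\<integral>\<^sup>+y. ennreal (exp (- s * l t y)) \<partial>P t) + ennreal (1 - \<gamma>))"
    using \<gamma> by (simp add: mult.commute)
  finally show "(\<integral>\<^sup>+\<omega>. ennreal (exp (- s * (\<Sum>t\<in>I. if fst \<omega> t then l t (snd \<omega> t) else 0))) \<partial>\<mu>)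
      = (\<Prod>t\<in>I. ennreal \<gamma> * (\<integral>\<^sup>+y. ennreal (exp (- s * l t y)) \<partial>P t) + ennreal (1 - \<gamma>))" .
qed

lemma penalized_ml_oracle_inequality:
  fixes P :: "'i \<Rightarrow> 'y measure" and l :: "'a \<Rightarrow> 'i \<Rightarrow> 'y \<Rightarrow> real" and h :: "'a \<Rightarrow> 'i \<Rightarrow> real"
    and k pen :: "'a \<Rightarrow> real" and s \<gamma> \<kappa> :: real
  assumes I: "finite I" and G: "finite G" and P: "\<And>t. prob_space (P t)" and \<gamma>: "0 < \<gamma>" "\<gamma> \<le> 1"
    and s: "0 < s" and \<kappa>: "0 \<le> \<kappa>"
    and l: "\<And>x t. x \<in> G \<Longrightarrow> t \<in> I \<Longrightarrow> integrable (P t) (l x t)"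
    and h: "\<And>x t. x \<in> G \<Longrightarrow> t \<in> I \<Longrightarrow> 0 \<le> h x t \<and> h x t \<le> \<kappa>"
    and mgf: "\<And>x t. x \<in> G \<Longrightarrow> t \<in> I \<Longrightarrow> (\<integral>\<^sup>+y. ennreal (exp (- s * l x t y)) \<partial>P t) \<le> ennreal (exp (- s * h x t))"
    and kraft: "(\<Sum>x\<in>G. exp (- k x)) \<le> 1"
    and pen: "\<And>x. x \<in> G \<Longrightarrow> k x / s \<le> pen x"
    and x0: "x0 \<in> G"
  defines "\<mu> \<equiv> PiM I (\<lambda>_. measure_pmf (bernoulli_pmf \<gamma>)) \<Otimes>\<^sub>M PiM I P"
    and "L \<equiv> (\<lambda>x \<omega>. \<Sum>t\<in>I. if fst \<omega> t then l x t (snd \<omega> t) else 0)"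
  assumes e: "AE \<omega> in \<mu>. e \<omega> \<in> G \<and> L (e \<omega>) \<omega> + pen (e \<omega>) \<le> L x0 \<omega> + pen x0"
  shows "(\<integral>\<^sup>+\<omega>. ennreal (\<Sum>t\<in>I. h (e \<omega>) t) \<partial>\<mu>)
     \<le> ennreal ((1 + s * \<kappa>) * ((\<Sum>t\<in>I. \<integral>y. l x0 t y \<partial>P t) + pen x0 / \<gamma>))"
proof -
  have \<gamma>': "0 \<le> \<gamma>" using \<gamma> by simp
  have lm: "l x t \<in> borel_measurable (P t)" if "x \<in> G" "t \<in> I" for x t
    using l[OF that] by (rule borel_measurable_integrable)
  interpret B1: prob_space "PiM I (\<lambda>_. measure_pmf (bernoulli_pmf \<gamma>))"
    by (intro prob_space_PiM measure_pmf.prob_space_axioms)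
  interpret Q1: prob_space "PiM I P" by (intro prob_space_PiM P)
  interpret pair_prob_space "PiM I (\<lambda>_. measure_pmf (bernoulli_pmf \<gamma>))" "PiM I P" ..
  interpret MU: prob_space \<mu> unfolding \<mu>_def by (rule prob_space_axioms)
  define g where "g = \<gamma> / (1 + s * \<kappa>)"
  have sk: "0 \<le> s * \<kappa>" using s \<kappa> by simp
  have g: "g > 0" using \<gamma> sk by (simp add: g_def)
  define f where "f x = (\<Sum>t\<in>I. h x t)" for x
  define E where "E x \<omega> = exp (s * g * f x - k x) * exp (- s * L x \<omega>)" for x \<omega>
  define Z where "Z \<omega> = (\<Sum>x\<in>G. E x \<omega>)" for \<omega>
  have iL: "integrable \<mu> (L x)" "(\<integral>\<omega>. L x \<omega> \<partial>\<mu>) = \<gamma> * (\<Sum>t\<in>I. \<integral>y. l x t y \<partial>P t)" if x: "x \<in> G" for x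
  proof -
    note a = integrable_masked[of I P \<gamma> "l x", OF I P \<gamma>' \<gamma>(2) lm[OF x] _ l[OF x], folded \<mu>_def]
      and b = integral_masked[of I P \<gamma> "l x", OF I P \<gamma>' \<gamma>(2) lm[OF x] _ l[OF x], folded \<mu>_def]
    show "integrable \<mu> (L x)" unfolding L_def using a by auto
    show "(\<integral>\<omega>. L x \<omega> \<partial>\<mu>) = \<gamma> * (\<Sum>t\<in>I. \<integral>y. l x t y \<partial>P t)"
      unfolding L_def using a b by (simp add: Bochner_Integration.integral_sum sum_distrib_left)
  qed
  have [measurable]: "L x \<in> borel_measurable \<mu>" if "x \<in> G" for x
    using iL(1)[OF that] by (rule borel_measurable_integrable)
  have Em[measurable]: "E x \<in> borel_measurable \<mu>" if "x \<in> G" for x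
    unfolding E_def using that by measurable
  have nnE: "(\<integral>\<^sup>+\<omega>. ennreal (E x \<omega>) \<partial>\<mu>) \<le> ennreal (exp (- k x))" if x: "x \<in> G" for x
  proof -
    have "(\<integral>\<^sup>+\<omega>. ennreal (exp (- s * L x \<omega>)) \<partial>\<mu>)
      = (\<Prod>t\<in>I. ennreal \<gamma> * (\<integral>\<^sup>+y. ennreal (exp (- s * l x t y)) \<partial>P t) + ennreal (1 - \<gamma>))"
      unfolding L_def \<mu>_def by (rule nn_integral_exp_masked[OF I P \<gamma>' \<gamma>(2) lm[OF x]])
    also have "\<dots> \<le> (\<Prod>t\<in>I. ennreal (exp (- (s * g * h x t))))"
    proof (rule prod_mono_ennreal)
      fix t assume t: "t \<in> I"
      have "ennreal \<gamma> * (\<integral>\<^sup>+y. ennreal (exp (- s * l x t y)) \<partial>P t) + ennreal (1 - \<gamma>)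
         \<le> ennreal \<gamma> * ennreal (exp (- s * h x t)) + ennreal (1 - \<gamma>)"
        by (intro add_mono mult_left_mono mgf x t) auto
      also have "\<dots> = ennreal (1 - \<gamma> + \<gamma> * exp (- s * h x t))"
        using \<gamma> by (simp add: ennreal_mult[symmetric] ennreal_plus[symmetric] add.commute del: ennreal_plus)
      also have "\<dots> \<le> ennreal (exp (- (s * g * h x t)))"
        using Bernoulli_mask_exp_bound[OF s \<gamma>', of "h x t" \<kappa>] h[OF x t]
        by (intro ennreal_leI) (simp add: g_def mult_ac)
      finally show "ennreal \<gamma> * (\<integral>\<^sup>+y. ennreal (exp (- s * l x t y)) \<partial>P t) + ennreal (1 - \<gamma>)
         \<le> ennreal (exp (- (s * g * h x t)))" .
    qed
    also have "\<dots> = ennreal (exp (- (s * g * f x)))"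
      using I by (simp add: prod_ennreal exp_sum[symmetric] f_def sum_distrib_left sum_negf)
    finally have *: "(\<integral>\<^sup>+\<omega>. ennreal (exp (- s * L x \<omega>)) \<partial>\<mu>) \<le> ennreal (exp (- (s * g * f x)))" .
    have "(\<integral>\<^sup>+\<omega>. ennreal (E x \<omega>) \<partial>\<mu>)
        = ennreal (exp (s * g * f x - k x)) * (\<integral>\<^sup>+\<omega>. ennreal (exp (- s * L x \<omega>)) \<partial>\<mu>)"
      unfolding E_def using x by (subst nn_integral_cmult[symmetric]) (auto simp: ennreal_mult)
    also have "\<dots> \<le> ennreal (exp (s * g * f x - k x)) * ennreal (exp (- (s * g * f x)))"
      by (rule mult_left_mono[OF *]) simp
    also have "\<dots> = ennreal (exp (- k x))"
      by (simp add: ennreal_mult[symmetric] exp_add[symmetric])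
    finally show ?thesis .
  qed
  have iE: "integrable \<mu> (E x)" if x: "x \<in> G" for x
    by (rule integrableI_nonneg)
       (use x Em nnE[OF x] in \<open>auto simp: E_def intro: le_less_trans[OF _ ennreal_less_top]\<close>)
  have EE: "(\<integral>\<omega>. E x \<omega> \<partial>\<mu>) \<le> exp (- k x)" if x: "x \<in> G" for x
  proof -
    have "ennreal (\<integral>\<omega>. E x \<omega> \<partial>\<mu>) = (\<integral>\<^sup>+\<omega>. ennreal (E x \<omega>) \<partial>\<mu>)"
      by (rule nn_integral_eq_integral[OF iE[OF x], symmetric]) (simp add: E_def)
    with nnE[OF x] have "ennreal (\<integral>\<omega>. E x \<omega> \<partial>\<mu>) \<le> ennreal (exp (- k x))" by (simp only:)
    then show ?thesis by (subst (asm) ennreal_le_iff) auto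
  qed
  have iZ: "integrable \<mu> Z" unfolding Z_def using iE by auto
  have EZ: "(\<integral>\<omega>. Z \<omega> \<partial>\<mu>) \<le> 1"
  proof -
    have "(\<integral>\<omega>. Z \<omega> \<partial>\<mu>) = (\<Sum>x\<in>G. \<integral>\<omega>. E x \<omega> \<partial>\<mu>)"
      unfolding Z_def using iE by (intro Bochner_Integration.integral_sum) auto
    also have "\<dots> \<le> (\<Sum>x\<in>G. exp (- k x))" by (intro sum_mono EE)
    finally show ?thesis using kraft by simp
  qed
  define R where "R \<omega> = ((Z \<omega> - 1) / s + L x0 \<omega> + pen x0) / g" for \<omega>
  have iR: "integrable \<mu> R"
    unfolding R_def using iZ iL(1)[OF x0]
    by (intro integrable_divide_zero Bochner_Integration.integrable_add Bochner_Integration.integrable_diff) auto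
  have R: "AE \<omega> in \<mu>. f (e \<omega>) \<le> R \<omega>"
    using e
  proof eventually_elim
    case (elim \<omega>)
    let ?x = "e \<omega>"
    have x: "?x \<in> G" using elim by simp
    have "s * g * f ?x - k ?x - s * L ?x \<omega> \<le> exp (s * g * f ?x - k ?x - s * L ?x \<omega>) - 1"
      using exp_ge_add_one_self[of "s * g * f ?x - k ?x - s * L ?x \<omega>"] by linarith
    also have "exp (s * g * f ?x - k ?x - s * L ?x \<omega>) = E ?x \<omega>" by (simp add: E_def exp_add[symmetric])
    also have "E ?x \<omega> \<le> Z \<omega>" unfolding Z_def
      by (rule member_le_sum) (use x G in \<open>auto simp: E_def\<close>)
    finally have "s * (g * f ?x - k ?x / s - L ?x \<omega>) \<le> Z \<omega> - 1" using s by (simp add: algebra_simps)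
    then have "g * f ?x - k ?x / s - L ?x \<omega> \<le> (Z \<omega> - 1) / s" using s by (simp add: pos_le_divide_eq mult.commute)
    with pen[OF x] elim have "g * f ?x \<le> (Z \<omega> - 1) / s + L x0 \<omega> + pen x0" by linarith
    then show ?case unfolding R_def using g by (simp add: pos_le_divide_eq mult.commute)
  qed
  have R0: "AE \<omega> in \<mu>. 0 \<le> R \<omega>"
    using R e
  proof eventually_elim
    case (elim \<omega>)
    have "0 \<le> f (e \<omega>)" unfolding f_def using elim h by (auto intro!: sum_nonneg)
    with elim show ?case by simp
  qed
  have "(\<integral>\<^sup>+\<omega>. ennreal (\<Sum>t\<in>I. h (e \<omega>) t) \<partial>\<mu>) \<le> (\<integral>\<^sup>+\<omega>. ennreal (R \<omega>) \<partial>\<mu>)"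
    by (rule nn_integral_mono_AE) (use R in \<open>auto simp: f_def elim!: eventually_mono intro!: ennreal_leI\<close>)
  also have "\<dots> = ennreal (\<integral>\<omega>. R \<omega> \<partial>\<mu>)"
    by (rule nn_integral_eq_integral[OF iR R0])
  also have "(\<integral>\<omega>. R \<omega> \<partial>\<mu>)
     = (((\<integral>\<omega>. Z \<omega> \<partial>\<mu>) - 1) / s + \<gamma> * (\<Sum>t\<in>I. \<integral>y. l x0 t y \<partial>P t) + pen x0) / g"
    unfolding R_def using iZ iL[OF x0] MU.prob_space by simp
  also have "\<dots> \<le> (\<gamma> * (\<Sum>t\<in>I. \<integral>y. l x0 t y \<partial>P t) + pen x0) / g"
    using EZ s g by (intro divide_right_mono) (auto simp: field_simps)
  also have "\<dots> = (1 + s * \<kappa>) * ((\<Sum>t\<in>I. \<integral>y. l x0 t y \<partial>P t) + pen x0 / \<gamma>)"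
    using \<gamma> sk by (simp add: g_def field_simps)
  finally show ?thesis by (simp add: ennreal_leI)
qed

lemma finite_box [simp]: "finite (box n1 n2 n3)"
  by (simp add: box_def)

lemma card_box: "card (box n1 n2 n3) = n1 * n2 * n3"
  by (simp add: box_def card_cartesian_product)

lemma levels_image: "levels th a = (\<lambda>k. a * real k / real (th - 1)) ` {..<th}"
  by (auto simp: levels_def)

lemma finite_levels [simp]: "finite (levels th a)"
  by (simp add: levels_image)

lemma card_levels_le: "card (levels th a) \<le> th"
  unfolding levels_image using card_image_le[of "{..<th}"] by simp

lemma
  fixes w :: "real \<Rightarrow> real" and S :: "real set"
  assumes I: "finite I" and S: "finite S" and w: "\<And>x. 0 \<le> w x"
  defines "F \<equiv> {A :: 'i \<Rightarrow> real. (\<forall>t\<in>I. A t \<in> S) \<and> (\<forall>t. t \<notin> I \<longrightarrow> A t = 0)}"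
  shows finite_supported_funs: "finite F"
    and sum_prod_supported_funs_le: "(\<Sum>A\<in>F. \<Prod>t\<in>I. w (A t)) \<le> (\<Sum>x\<in>S. w x) ^ card I"
proof -
  have inj: "inj_on (\<lambda>A. restrict A I) F"
  proof (rule inj_onI, rule ext)
    fix A B t assume *: "A \<in> F" "B \<in> F" "restrict A I = restrict B I"
    show "A t = B t"
    proof (cases "t \<in> I")
      case True
      with fun_cong[OF *(3), of t] show ?thesis by simp
    qed (use * in \<open>auto simp: F_def\<close>)
  qed
  have sub: "(\<lambda>A. restrict A I) ` F \<subseteq> PiE I (\<lambda>_. S)" by (auto simp: F_def)
  have fin: "finite (PiE I (\<lambda>_. S))" using I S by (intro finite_PiE) auto
  show "finite F" using finite_imageD[OF finite_subset[OF sub fin] inj] .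
  have "(\<Sum>A\<in>F. \<Prod>t\<in>I. w (A t)) = (\<Sum>A\<in>(\<lambda>A. restrict A I) ` F. \<Prod>t\<in>I. w (A t))"
    by (subst sum.reindex[OF inj]) (auto intro!: sum.cong prod.cong)
  also have "\<dots> \<le> (\<Sum>A\<in>PiE I (\<lambda>_. S). \<Prod>t\<in>I. w (A t))"
    by (rule sum_mono2[OF fin sub]) (auto intro!: prod_nonneg w)
  also have "\<dots> = (\<Prod>t\<in>I. \<Sum>x\<in>S. w x)"
    by (rule prod_sum_PiE[symmetric]) (use I S in auto)
  finally show "(\<Sum>A\<in>F. \<Prod>t\<in>I. w (A t)) \<le> (\<Sum>x\<in>S. w x) ^ card I" by simp
qed

lemma finite_frakL: "finite (frakL n1 r n3 th)"
  unfolding frakL_def by (rule finite_supported_funs) auto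

lemma frakD_eq:
  "frakD r n2 n3 th b = {B. (\<forall>t\<in>box r n2 n3. B t \<in> insert 0 (levels th b)) \<and> (\<forall>t. t \<notin> box r n2 n3 \<longrightarrow> B t = 0)}"
  by (simp add: frakD_def)

lemma finite_frakD: "finite (frakD r n2 n3 th b)"
  unfolding frakD_eq by (rule finite_supported_funs) auto

lemma Gamma_subset: "Gamma n1 n2 n3 r th b c \<subseteq> frakL n1 r n3 th \<times> frakD r n2 n3 th b"
  by (auto simp: Gamma_def)

lemma finite_Gamma: "finite (Gamma n1 n2 n3 r th b c)"
  using Gamma_subset finite_frakL finite_frakD by (meson finite_SigmaI finite_subset)

lemma card_frakL_le: "card (frakL n1 r n3 th) \<le> real th ^ (n1 * r * n3)"
proof -
  have "(\<Sum>A\<in>frakL n1 r n3 th. \<Prod>t\<in>box n1 r n3. (1::real)) \<le> (\<Sum>x\<in>levels th 1. 1) ^ card (box n1 r n3)"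
    unfolding frakL_def by (rule sum_prod_supported_funs_le) auto
  then have "real (card (frakL n1 r n3 th)) \<le> real (card (levels th 1)) ^ (n1 * r * n3)"
    by (simp add: card_box)
  also have "\<dots> \<le> real th ^ (n1 * r * n3)"
    by (intro power_mono) (use card_levels_le in auto)
  finally show ?thesis .
qed

lemma sum_power_l0_le:
  fixes q :: real
  assumes q: "0 \<le> q"
  shows "(\<Sum>B\<in>frakD r n2 n3 th b. q ^ l0 r n2 n3 B) \<le> (1 + real th * q) ^ (r * n2 * n3)"
proof -
  define w where "w x = (if x \<noteq> 0 then q else 1)" for x :: real
  have "q ^ l0 r n2 n3 B = (\<Prod>t\<in>box r n2 n3. w (B t))" for B
    unfolding w_def l0_def by (simp add: prod.If_cases Int_def)
  then have "(\<Sum>B\<in>frakD r n2 n3 th b. q ^ l0 r n2 n3 B)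
      = (\<Sum>B\<in>frakD r n2 n3 th b. \<Prod>t\<in>box r n2 n3. w (B t))" by simp
  also have "\<dots> \<le> (\<Sum>x\<in>insert 0 (levels th b). w x) ^ card (box r n2 n3)"
    unfolding frakD_eq by (rule sum_prod_supported_funs_le) (use q in \<open>auto simp: w_def\<close>)
  also have "\<dots> \<le> (1 + real th * q) ^ card (box r n2 n3)"
  proof (rule power_mono)
    have "(\<Sum>x\<in>insert 0 (levels th b). w x) = 1 + (\<Sum>x\<in>levels th b - {0}. w x)"
      by (simp add: sum.insert_remove w_def)
    also have "(\<Sum>x\<in>levels th b - {0}. w x) = real (card (levels th b - {0})) * q"
      by (simp add: w_def)
    also have "\<dots> \<le> real th * q"
      using q card_levels_le[of th b] card_Diff1_le[of "levels th b" 0]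
      by (intro mult_right_mono) linarith+
    finally show "(\<Sum>x\<in>insert 0 (levels th b). w x) \<le> 1 + real th * q" by simp
    show "0 \<le> (\<Sum>x\<in>insert 0 (levels th b). w x)" by (rule sum_nonneg) (use q in \<open>auto simp: w_def\<close>)
  qed
  finally show ?thesis by (simp add: card_box)
qed

lemma theta_weight_bound:
  fixes n1 n2 n3 :: nat and \<beta> :: real
  assumes n: "n1 \<ge> 2" "n3 \<ge> 1" and \<beta>: "\<beta> \<ge> 0"
  defines "x \<equiv> real (theta \<beta> n1 n2) * exp (- (2 * (\<beta> + 2) * ln (real (max n1 n2) * sqrt (real n3))))"
  shows "real (max n1 n2) * x \<le> 1 / 4"
proof -
  define N where "N = real (max n1 n2)"
  have N: "N \<ge> 2" using n by (simp add: N_def)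
  have lN: "ln N \<ge> ln 2" "ln N > 0" using N by auto
  have "real_of_int \<lceil>\<beta> * log 2 N\<rceil> \<le> \<beta> * log 2 N + 1" by linarith
  moreover have "\<beta> * log 2 N \<ge> 0" using \<beta> N by simp
  ultimately have c: "real (nat \<lceil>\<beta> * log 2 N\<rceil>) \<le> \<beta> * log 2 N + 1" by simp
  have "real (theta \<beta> n1 n2) = 2 powr real (nat \<lceil>\<beta> * log 2 N\<rceil>)"
    by (simp add: theta_def N_def powr_realpow)
  also have "\<dots> \<le> 2 powr (\<beta> * log 2 N + 1)" using c by simp
  also have "\<dots> = exp (\<beta> * ln N + ln 2)" by (simp add: powr_def log_def field_simps)
  finally have th: "real (theta \<beta> n1 n2) \<le> exp (\<beta> * ln N + ln 2)" .
  have "ln (N * sqrt (real n3)) \<ge> ln N"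
    using N n by simp
  then have "2 * (\<beta> + 2) * ln (N * sqrt (real n3)) \<ge> 2 * (\<beta> + 2) * ln N"
    using \<beta> by (intro mult_left_mono) auto
  then have "exp (- (2 * (\<beta> + 2) * ln (N * sqrt (real n3)))) \<le> exp (- (2 * (\<beta> + 2) * ln N))" by simp
  with th have "x \<le> exp (\<beta> * ln N + ln 2) * exp (- (2 * (\<beta> + 2) * ln N))"
    unfolding x_def N_def[symmetric] by (intro mult_mono) auto
  then have "N * x \<le> exp (ln N) * (exp (\<beta> * ln N + ln 2) * exp (- (2 * (\<beta> + 2) * ln N)))"
    using N by simp
  also have "\<dots> = exp (ln 2 - (\<beta> + 3) * ln N)"
    by (simp add: exp_add[symmetric] algebra_simps)
  also have "\<dots> \<le> exp (- 2 * ln N)"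
  proof -
    have "\<beta> * ln N \<ge> 0" using \<beta> lN by simp
    then have "ln 2 - (\<beta> + 3) * ln N \<le> - 2 * ln N" using lN by (simp add: algebra_simps)
    then show ?thesis by simp
  qed
  also have "\<dots> \<le> exp (- 2 * ln 2)" using lN by simp
  also have "\<dots> = 1 / 4"
  proof -
    have "exp (ln 2 + ln 2) = (4::real)" by (subst exp_add) simp
    then show ?thesis by (simp add: exp_minus)
  qed
  finally show ?thesis by (simp add: N_def)
qed

lemma Gamma_kraft:
  fixes n1 n2 n3 r :: nat and \<beta> b c :: real
  assumes n: "n1 \<ge> 2" "n3 \<ge> 1" and \<beta>: "\<beta> \<ge> 0"
  shows "(\<Sum>AB\<in>Gamma n1 n2 n3 r (theta \<beta> n1 n2) b c.
      exp (- (2 * (\<beta> + 2) * ln (real (max n1 n2) * sqrt (real n3)) * (real (r * n1 * n3) + real (l0 r n2 n3 (snd AB)))))) \<le> 1"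
proof -
  define K where "K = 2 * (\<beta> + 2) * ln (real (max n1 n2) * sqrt (real n3))"
  define q where "q = exp (- K)"
  let ?th = "theta \<beta> n1 n2"
  define x where "x = real ?th * q"
  define N where "N = real (max n1 n2)"
  have q: "q > 0" by (simp add: q_def)
  have x0: "x \<ge> 0" by (simp add: x_def q_def)
  have Nx: "N * x \<le> 1 / 4"
    using theta_weight_bound[OF n \<beta>, of n2] by (simp add: x_def q_def K_def N_def)
  have N: "N \<ge> 2" using n by (simp add: N_def)
  have x1: "x \<le> 1 / 4" using Nx mult_right_mono[OF N x0] x0 by linarith
  have ex: "exp (- (K * (real (r * n1 * n3) + real (l0 r n2 n3 B)))) = q ^ (n1 * r * n3) * q ^ l0 r n2 n3 B" for B
    by (simp add: q_def exp_of_nat_mult[symmetric] exp_add[symmetric] algebra_simps)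
  have "(\<Sum>AB\<in>Gamma n1 n2 n3 r ?th b c. exp (- (K * (real (r * n1 * n3) + real (l0 r n2 n3 (snd AB))))))
      \<le> (\<Sum>AB\<in>frakL n1 r n3 ?th \<times> frakD r n2 n3 ?th b. q ^ (n1 * r * n3) * q ^ l0 r n2 n3 (snd AB))"
    unfolding ex using q by (intro sum_mono2 Gamma_subset finite_SigmaI finite_frakL finite_frakD) auto
  also have "\<dots> = real (card (frakL n1 r n3 ?th)) * q ^ (n1 * r * n3) * (\<Sum>B\<in>frakD r n2 n3 ?th b. q ^ l0 r n2 n3 B)"
    by (simp add: sum.cartesian_product' sum_distrib_left mult_ac)
  also have "\<dots> \<le> real ?th ^ (n1 * r * n3) * q ^ (n1 * r * n3) * (1 + x) ^ (r * n2 * n3)"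
    using q by (intro mult_mono card_frakL_le sum_power_l0_le[of q, folded x_def])
      (auto simp: x_def intro!: sum_nonneg sum_power_l0_le)
  also have "\<dots> = (x ^ n1 * (1 + x) ^ n2) ^ (r * n3)"
    by (simp add: x_def power_mult_distrib power_mult[symmetric] mult_ac)
  also have "\<dots> \<le> 1"
  proof (rule power_le_one)
    show "0 \<le> x ^ n1 * (1 + x) ^ n2" using x0 by simp
    have "x ^ n1 \<le> x ^ 1" using n x0 x1 by (intro power_decreasing) auto
    moreover have "(1 + x) ^ n2 \<le> 3"
    proof -
      have "(1 + x) ^ n2 \<le> exp x ^ n2" using x0 by (intro power_mono exp_ge_add_one_self) auto
      also have "\<dots> = exp (real n2 * x)" by (simp add: exp_of_nat_mult)
      also have "\<dots> \<le> exp 1"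
      proof -
        have "real n2 * x \<le> N * x" using x0 by (intro mult_right_mono) (auto simp: N_def)
        with Nx show ?thesis by simp
      qed
      also have "\<dots> \<le> (3::real)" using exp_le by simp
      finally show ?thesis .
    qed
    ultimately have "x ^ n1 * (1 + x) ^ n2 \<le> x ^ 1 * 3" using x0 by (intro mult_mono) auto
    with x1 show "x ^ n1 * (1 + x) ^ n2 \<le> 1" by simp
  qed
  finally show ?thesis by (simp add: K_def)
qed

lemma AE_pair_measure_snd:
  assumes "sigma_finite_measure M2" and "AE y in M2. Q y"
  shows "AE \<omega> in M1 \<Otimes>\<^sub>M M2. Q (snd \<omega>)"
proof -
  interpret sigma_finite_measure M2 by fact
  obtain N where N: "{y \<in> space M2. \<not> Q y} \<subseteq> N" "emeasure M2 N = 0" "N \<in> sets M2"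
    using assms(2) by (rule AE_E)
  show ?thesis
  proof (rule AE_I')
    show "space M1 \<times> N \<in> null_sets (M1 \<Otimes>\<^sub>M M2)"
      using N by (intro null_setsI) (auto simp: emeasure_pair_measure_Times)
    show "{\<omega> \<in> space (M1 \<Otimes>\<^sub>M M2). \<not> Q (snd \<omega>)} \<subseteq> space M1 \<times> N"
      using N(1) by (auto simp: space_pair_measure)
  qed
qed

lemma KL_le_erealD:
  assumes "KL M p q \<le> ereal \<kappa>"
  shows "AE y in density M (\<lambda>y. ennreal (p y)). q y > 0"
    and "integrable (density M (\<lambda>y. ennreal (p y))) (\<lambda>y. ln (p y / q y))"
    and "KL M p q = ereal (\<integral>y. ln (p y / q y) \<partial>density M (\<lambda>y. ennreal (p y)))"
    and "(\<integral>y. ln (p y / q y) \<partial>density M (\<lambda>y. ennreal (p y))) \<le> \<kappa>"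
  using assms by (auto simp: KL_def split: if_splits)

lemma zero_in_Gamma:
  assumes "th > 0" "c \<ge> 0"
  shows "((\<lambda>_. 0), (\<lambda>_. 0)) \<in> Gamma n1 n2 n3 r th b c"
  using assms by (auto simp: Gamma_def frakL_def frakD_def levels_def tprod_def)

lemma nlog_prod_pos:
  assumes "finite I" "\<And>t. t \<in> I \<Longrightarrow> 0 < f t"
  shows "nlog (\<Prod>t\<in>I. f t) = ereal (- (\<Sum>t\<in>I. ln (f t)))"
proof -
  have "(\<Prod>t\<in>I. f t) > 0" using assms by (intro prod_pos) auto
  moreover have "ln (\<Prod>t\<in>I. f t) = (\<Sum>t\<in>I. ln (f t))" using assms by (intro ln_prod) (auto simp: less_le)
  ultimately show ?thesis by (simp add: nlog_def)
qed

theorem theorem1: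
  fixes M :: "'y measure" and p :: "real \<Rightarrow> 'y \<Rightarrow> real"
    and n1 n2 n3 r m :: nat and b c \<beta> \<kappa> lam :: real
    and Astar Bstar Xstar :: tensor
    and est :: "idx set \<Rightarrow> (idx \<Rightarrow> 'y) \<Rightarrow> tensor \<times> tensor"
  assumes n: "n1 \<ge> 2" "n2 \<ge> 2" "n3 \<ge> 2" and r: "r \<le> min n1 n2"
    and bc: "b > 0" "c > 0"
    and fam: "\<And>x. 0 \<le> x \<Longrightarrow> x \<le> c \<Longrightarrow> p x \<in> borel_measurable M \<and> (\<forall>y. 0 \<le> p x y)
                 \<and> prob_space (density M (\<lambda>y. ennreal (p x y)))"
    and A: "\<forall>t\<in>box n1 r n3. 0 \<le> Astar t \<and> Astar t \<le> 1"
    and B: "\<forall>t\<in>box r n2 n3. 0 \<le> Bstar t \<and> Bstar t \<le> b"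
    and X: "\<forall>t\<in>box n1 n2 n3. Xstar t = tprod r n3 Astar Bstar t \<and> 0 \<le> Xstar t \<and> Xstar t \<le> c / 2"
    and m: "4 \<le> m" "m \<le> n1 * n2 * n3"
    and \<beta>: "\<beta> \<ge> 3"
    and \<kappa>: "\<forall>AB\<in>Gamma n1 n2 n3 r (theta \<beta> n1 n2) b c. \<forall>t\<in>box n1 n2 n3.
               KL M (p (Xstar t)) (p (tprod r n3 (fst AB) (snd AB) t)) \<le> ereal \<kappa>"
    and lam: "lam \<ge> 4 * (\<beta> + 2) * (1 + 2 * \<kappa> / 3) * ln (real (max n1 n2) * sqrt (real n3))"
    and est: "\<forall>\<Omega> Y. \<Omega> \<subseteq> box n1 n2 n3 \<longrightarrow>
               est \<Omega> Y \<in> Gamma n1 n2 n3 r (theta \<beta> n1 n2) b c \<and>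
               (\<forall>AB\<in>Gamma n1 n2 n3 r (theta \<beta> n1 n2) b c.
                  objective p n2 n3 r lam \<Omega> Y (est \<Omega> Y) \<le> objective p n2 n3 r lam \<Omega> Y AB)"
  shows
    "enn2ereal (\<integral>\<^sup>+ \<omega>Y. (let \<Omega> = {t\<in>box n1 n2 n3. fst \<omega>Y t};
                              AB = est \<Omega> (restrict (snd \<omega>Y) \<Omega>)
                          in e2ennreal (2 * nlog (hellt M p (box n1 n2 n3)
                                 (tprod r n3 (fst AB) (snd AB)) Xstar)))
          \<partial>(PiM (box n1 n2 n3) (\<lambda>_. measure_pmf (bernoulli_pmf (real m / real (n1 * n2 * n3))))
             \<Otimes>\<^sub>M PiM (box n1 n2 n3) (\<lambda>t. density M (\<lambda>y. ennreal (p (Xstar t) y)))))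
       / ereal (real (n1 * n2 * n3))
     \<le> 3 * Min ((\<lambda>AB. KLt M p (box n1 n2 n3) Xstar (tprod r n3 (fst AB) (snd AB)) / ereal (real (n1 * n2 * n3))
                  + ereal ((lam + 8 * \<kappa> * (\<beta> + 2) * ln (real (max n1 n2) * sqrt (real n3)) / 3)
                           * (real (r * n1 * n3) + real (l0 r n2 n3 (snd AB))) / real m))
                ` Gamma n1 n2 n3 r (theta \<beta> n1 n2) b c)
       + ereal (8 * \<kappa> * ln (real m) / real m)"
proof -
  define I where "I = box n1 n2 n3"
  define G where "G = Gamma n1 n2 n3 r (theta \<beta> n1 n2) b c"
  define Xf where "Xf AB = tprod r n3 (fst AB) (snd AB)" for AB :: "tensor \<times> tensor"
  define Xs where "Xs t = (if t \<in> I then Xstar t else 0)" for t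
  define P where "P t = density M (\<lambda>y. ennreal (p (Xs t) y))" for t
  define \<gamma> where "\<gamma> = real m / real (n1 * n2 * n3)"
  define \<mu> where "\<mu> = PiM I (\<lambda>_. measure_pmf (bernoulli_pmf \<gamma>)) \<Otimes>\<^sub>M PiM I P"
  define LL where "LL = ln (real (max n1 n2) * sqrt (real n3))"
  define size where "size AB = real (r * n1 * n3) + real (l0 r n2 n3 (snd AB))" for AB :: "tensor \<times> tensor"
  define l where "l AB t y = ln (p (Xs t) y / p (Xf AB t) y)" for AB t y
  define h where "h AB t = - 2 * ln (hell M (p (Xf AB t)) (p (Xs t)))" for AB t
  define s where "s = 1 / (2 + 4 * \<kappa> / 3)"
  define e where "e \<omega> = (let \<Omega> = {t \<in> I. fst \<omega> t} in est \<Omega> (restrict (snd \<omega>) \<Omega>))" for \<omega>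
  define L where "L AB \<omega> = (\<Sum>t\<in>I. if fst \<omega> t then l AB t (snd \<omega> t) else 0)" for AB \<omega>
  have finI: "finite I" by (simp add: I_def)
  have finG: "finite G" by (simp add: G_def finite_Gamma)
  have th: "theta \<beta> n1 n2 > 0" by (simp add: theta_def)
  have G_ne: "G \<noteq> {}" using zero_in_Gamma[OF th, of c n1 n2 n3 r b] bc by (auto simp: G_def)
  have Xs_range: "0 \<le> Xs t" "Xs t \<le> c" for t using X bc by (auto simp: Xs_def I_def)
  note famS = fam[OF Xs_range]
  have famX: "p (Xf AB t) \<in> borel_measurable M" "\<And>y. 0 \<le> p (Xf AB t) y"
      "prob_space (density M (\<lambda>y. ennreal (p (Xf AB t) y)))" if "AB \<in> G" "t \<in> I" for AB t
    using fam[of "Xf AB t"] that by (auto simp: G_def I_def Gamma_def Xf_def)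
  have KLb: "KL M (p (Xs t)) (p (Xf AB t)) \<le> ereal \<kappa>" if "AB \<in> G" "t \<in> I" for AB t
    using \<kappa> that by (auto simp: Xs_def G_def I_def Xf_def)
  note KLD = KL_le_erealD[OF KLb]
  have h_eq: "h AB t = - 2 * ln (hell M (p (Xs t)) (p (Xf AB t)))" if "AB \<in> G" "t \<in> I" for AB t
    unfolding h_def using hell_commute[of "p (Xs t)" M "p (Xf AB t)"] famS famX[OF that] by simp
  have hellS: "0 < hell M (p (Xs t)) (p (Xf AB t))" "hell M (p (Xs t)) (p (Xf AB t)) \<le> 1"
    if "AB \<in> G" "t \<in> I" for AB t
    using hell_pos[of "p (Xs t)" M "p (Xf AB t)"] hell_le_1[of "p (Xs t)" M "p (Xf AB t)"]
      famS famX[OF that] KLD(1)[OF that] by auto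
  have hellX: "0 < hell M (p (Xf AB t)) (p (Xs t))" if "AB \<in> G" "t \<in> I" for AB t
    using hell_commute[of "p (Xs t)" M "p (Xf AB t)"] famS famX[OF that] hellS[OF that] by simp
  have hD: "h AB t \<le> (\<integral>y. l AB t y \<partial>P t)" if "AB \<in> G" "t \<in> I" for AB t
    unfolding h_eq[OF that] l_def P_def
    using log_hell_le_KL[of "p (Xs t)" M "p (Xf AB t)"] famS famX[OF that] KLD[OF that] by simp
  have h0: "0 \<le> h AB t" if "AB \<in> G" "t \<in> I" for AB t
    unfolding h_eq[OF that] using hellS[OF that] by simp
  have hk: "h AB t \<le> \<kappa>" if "AB \<in> G" "t \<in> I" for AB t
    using hD[OF that] KLD(4)[OF that] by (simp add: l_def P_def)
  have "(0, 0, 0) \<in> I" using n by (auto simp: I_def box_def)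
  with G_ne h0 hk have \<kappa>0: "0 \<le> \<kappa>" by (metis all_not_in_conv order_trans)
  have s: "0 < s" "s \<le> 1 / 2" "s * \<kappa> \<le> 2" using \<kappa>0 by (auto simp: s_def field_simps)
  have n0: "real (n1 * n2 * n3) > 0" using n by simp
  have \<gamma>: "0 < \<gamma>" "\<gamma> \<le> 1"
    unfolding \<gamma>_def using m n0 by (simp_all add: divide_le_eq del: of_nat_mult)
  have LL0: "0 \<le> LL"
  proof -
    have "1 * 1 \<le> real (max n1 n2) * sqrt (real n3)" using n by (intro mult_mono) auto
    then show ?thesis unfolding LL_def by (intro ln_ge_zero) simp
  qed
  have lamLL: "4 * (\<beta> + 2) * (1 + 2 * \<kappa> / 3) * LL \<le> lam" using lam by (simp add: LL_def)
  have lam0: "0 \<le> lam"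
    by (rule order_trans[OF _ lamLL]) (use \<beta> \<kappa>0 LL0 in simp)
  have size0: "0 \<le> size AB" for AB by (simp add: size_def)
  have P_prob: "prob_space (P t)" for t unfolding P_def using famS by simp
  have li: "integrable (P t) (l AB t)" if "AB \<in> G" "t \<in> I" for AB t
    using KLD(2)[OF that] by (simp add: l_def[abs_def] P_def)
  have mgf: "(\<integral>\<^sup>+y. ennreal (exp (- s * l AB t y)) \<partial>P t) \<le> ennreal (exp (- s * h AB t))"
    if "AB \<in> G" "t \<in> I" for AB t
    using likelihood_ratio_mgf[of "p (Xs t)" M "p (Xf AB t)" s] famS famX[OF that] KLD(1)[OF that] s
    by (simp add: l_def P_def h_eq[OF that] mult_ac)
  have kraft: "(\<Sum>AB\<in>G. exp (- (2 * (\<beta> + 2) * LL * size AB))) \<le> 1"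
    unfolding G_def LL_def size_def using n \<beta> by (intro Gamma_kraft) auto
  have pen: "2 * (\<beta> + 2) * LL * size AB / s \<le> lam * size AB" for AB
  proof -
    have "2 * (\<beta> + 2) * LL * size AB / s = 4 * (\<beta> + 2) * (1 + 2 * \<kappa> / 3) * LL * size AB"
      by (simp add: s_def algebra_simps)
    also have "\<dots> \<le> lam * size AB" using lamLL size0 by (rule mult_right_mono)
    finally show ?thesis .
  qed
  have eG: "e \<omega> \<in> G" for \<omega>
    using est by (auto simp: e_def G_def I_def Let_def)
  have pos: "AE \<omega> in \<mu>. \<forall>t\<in>I. p (Xs t) (snd \<omega> t) > 0 \<and> (\<forall>AB\<in>G. p (Xf AB t) (snd \<omega> t) > 0)"
    unfolding \<mu>_def
  proof (rule AE_pair_measure_snd)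
    show "sigma_finite_measure (PiM I P)"
      by (intro prob_space_imp_sigma_finite prob_space_PiM P_prob)
    show "AE Y in PiM I P. \<forall>t\<in>I. p (Xs t) (Y t) > 0 \<and> (\<forall>AB\<in>G. p (Xf AB t) (Y t) > 0)"
    proof (rule AE_finite_allI[OF finI])
      fix t assume t: "t \<in> I"
      have "AE y in P t. p (Xs t) y > 0"
        unfolding P_def using famS by (subst AE_density) auto
      moreover have "AE y in P t. \<forall>AB\<in>G. p (Xf AB t) y > 0"
        unfolding P_def by (rule AE_finite_allI[OF finG]) (rule KLD(1)[OF _ t])
      ultimately have "AE y in P t. p (Xs t) y > 0 \<and> (\<forall>AB\<in>G. p (Xf AB t) y > 0)" by eventually_elim auto
      then show "AE Y in PiM I P. p (Xs t) (Y t) > 0 \<and> (\<forall>AB\<in>G. p (Xf AB t) (Y t) > 0)"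
        by (rule AE_PiM_component[OF P_prob t])
    qed
  qed
  have opt: "AE \<omega> in \<mu>. \<forall>x0\<in>G. L (e \<omega>) \<omega> + lam * size (e \<omega>) \<le> L x0 \<omega> + lam * size x0"
    using pos
  proof (rule eventually_mono, intro ballI)
    fix \<omega> :: "(idx \<Rightarrow> bool) \<times> (idx \<Rightarrow> 'y)" and x0
    assume \<omega>: "\<forall>t\<in>I. p (Xs t) (snd \<omega> t) > 0 \<and> (\<forall>AB\<in>G. p (Xf AB t) (snd \<omega> t) > 0)" and x0: "x0 \<in> G"
    define \<Omega> where "\<Omega> = {t \<in> I. fst \<omega> t}"
    define Y where "Y = restrict (snd \<omega>) \<Omega>"
    have fin\<Omega>: "finite \<Omega>" using finI by (simp add: \<Omega>_def)
    have obj: "objective p n2 n3 r lam \<Omega> Y AB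
        = ereal (- (\<Sum>t\<in>\<Omega>. ln (p (Xf AB t) (snd \<omega> t))) + lam * real (l0 r n2 n3 (snd AB)))"
      if "AB \<in> G" for AB
    proof -
      have "(\<Prod>t\<in>\<Omega>. p (tprod r n3 (fst AB) (snd AB) t) (Y t)) = (\<Prod>t\<in>\<Omega>. p (Xf AB t) (snd \<omega> t))"
        by (auto simp: Y_def Xf_def)
      moreover have "nlog (\<Prod>t\<in>\<Omega>. p (Xf AB t) (snd \<omega> t)) = ereal (- (\<Sum>t\<in>\<Omega>. ln (p (Xf AB t) (snd \<omega> t))))"
        by (rule nlog_prod_pos[OF fin\<Omega>]) (use \<omega> that in \<open>auto simp: \<Omega>_def\<close>)
      ultimately show ?thesis by (simp add: objective_def)
    qed
    have LL_eq: "L AB \<omega> = (\<Sum>t\<in>\<Omega>. ln (p (Xs t) (snd \<omega> t))) - (\<Sum>t\<in>\<Omega>. ln (p (Xf AB t) (snd \<omega> t)))"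
      if "AB \<in> G" for AB
    proof -
      have "L AB \<omega> = (\<Sum>t\<in>\<Omega>. l AB t (snd \<omega> t))"
        unfolding L_def \<Omega>_def using finI by (simp add: sum.inter_filter)
      also have "\<dots> = (\<Sum>t\<in>\<Omega>. ln (p (Xs t) (snd \<omega> t)) - ln (p (Xf AB t) (snd \<omega> t)))"
        using \<omega> that by (intro sum.cong refl) (simp add: l_def \<Omega>_def ln_div less_imp_neq[THEN not_sym])
      finally show ?thesis by (simp add: sum_subtractf)
    qed
    have "e \<omega> = est \<Omega> Y" by (simp add: e_def \<Omega>_def Y_def Let_def)
    moreover have "objective p n2 n3 r lam \<Omega> Y (est \<Omega> Y) \<le> objective p n2 n3 r lam \<Omega> Y x0"
      using est x0 by (auto simp: G_def \<Omega>_def I_def)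
    ultimately have "objective p n2 n3 r lam \<Omega> Y (e \<omega>) \<le> objective p n2 n3 r lam \<Omega> Y x0" by simp
    then show "L (e \<omega>) \<omega> + lam * size (e \<omega>) \<le> L x0 \<omega> + lam * size x0"
      unfolding obj[OF eG] obj[OF x0] LL_eq[OF eG] LL_eq[OF x0] size_def by (simp add: algebra_simps)
  qed
  define risk where "risk AB = KLt M p I Xstar (Xf AB) / ereal (real (n1 * n2 * n3))
       + ereal ((lam + 8 * \<kappa> * (\<beta> + 2) * LL / 3) * size AB / real m)" for AB
  have "Min (risk ` G) \<in> risk ` G" by (rule Min_in) (simp_all add: finG G_ne)
  then obtain x0 where Min_x0: "Min (risk ` G) = risk x0" and x0: "x0 \<in> G" by (rule imageE)
  define D where "D = (\<Sum>t\<in>I. \<integral>y. l x0 t y \<partial>P t)"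
  have D0: "0 \<le> D" unfolding D_def
    by (rule sum_nonneg) (rule order_trans[OF h0[OF x0] hD[OF x0]])
  have KLt_D: "KLt M p I Xstar (Xf x0) = ereal D"
  proof -
    have "KLt M p I Xstar (Xf x0) = (\<Sum>t\<in>I. ereal (\<integral>y. l x0 t y \<partial>P t))"
      unfolding KLt_def
      by (rule sum.cong) (use KLD(3)[OF x0] in \<open>auto simp: Xs_def l_def P_def\<close>)
    then show ?thesis by (simp add: D_def)
  qed
  define R where "R = (1 + s * \<kappa>) * (D + lam * size x0 / \<gamma>)"
  have inner0: "0 \<le> D + lam * size x0 / \<gamma>" using D0 lam0 size0 \<gamma> by simp
  have sk0: "0 \<le> s * \<kappa>" using s \<kappa>0 by simp
  have R0: "0 \<le> R" unfolding R_def using inner0 sk0 by simp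
  have main: "(\<integral>\<^sup>+\<omega>. ennreal (\<Sum>t\<in>I. h (e \<omega>) t) \<partial>\<mu>) \<le> ennreal R"
    unfolding R_def D_def \<mu>_def
  proof (rule penalized_ml_oracle_inequality[where G=G and k="\<lambda>AB. 2 * (\<beta> + 2) * LL * size AB" and pen="\<lambda>AB. lam * size AB"])
    show "AE \<omega> in PiM I (\<lambda>_. measure_pmf (bernoulli_pmf \<gamma>)) \<Otimes>\<^sub>M PiM I P. e \<omega> \<in> G \<and>
        (\<Sum>t\<in>I. if fst \<omega> t then l (e \<omega>) t (snd \<omega> t) else 0) + lam * size (e \<omega>)
        \<le> (\<Sum>t\<in>I. if fst \<omega> t then l x0 t (snd \<omega> t) else 0) + lam * size x0"
      using opt x0 eG unfolding L_def \<mu>_def by (auto elim!: eventually_mono)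
  qed (use finI finG P_prob \<gamma> s \<kappa>0 li h0 hk mgf kraft pen x0 in auto)
  have PiM_eq: "PiM I (\<lambda>t. density M (\<lambda>y. ennreal (p (Xstar t) y))) = PiM I P"
    by (rule PiM_cong) (auto simp: P_def Xs_def)
  have "e2ennreal (2 * nlog (hellt M p I (Xf (e \<omega>)) Xstar)) = ennreal (\<Sum>t\<in>I. h (e \<omega>) t)" for \<omega>
  proof -
    have "hellt M p I (Xf (e \<omega>)) Xstar = (\<Prod>t\<in>I. hell M (p (Xf (e \<omega>) t)) (p (Xs t)))"
      unfolding hellt_def by (rule prod.cong) (auto simp: Xs_def)
    then have "nlog (hellt M p I (Xf (e \<omega>)) Xstar) = ereal (- (\<Sum>t\<in>I. ln (hell M (p (Xf (e \<omega>) t)) (p (Xs t)))))"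
      using nlog_prod_pos[OF finI hellX[OF eG]] by simp
    then have "2 * nlog (hellt M p I (Xf (e \<omega>)) Xstar) = ereal (\<Sum>t\<in>I. h (e \<omega>) t)"
      by (simp add: h_def sum_distrib_left sum_negf numeral_eq_ereal)
    then show ?thesis by simp
  qed
  then have integrand: "(let \<Omega> = {t \<in> I. fst \<omega> t}; AB = est \<Omega> (restrict (snd \<omega>) \<Omega>)
      in e2ennreal (2 * nlog (hellt M p I (tprod r n3 (fst AB) (snd AB)) Xstar))) = ennreal (\<Sum>t\<in>I. h (e \<omega>) t)" for \<omega>
    by (simp add: Let_def e_def Xf_def)
  have real_bound: "R / real (n1 * n2 * n3) \<le> 3 * (D / real (n1 * n2 * n3)
      + (lam + 8 * \<kappa> * (\<beta> + 2) * LL / 3) * size x0 / real m) + 8 * \<kappa> * ln (real m) / real m"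
  proof -
    have m0: "real m > 0" using m by simp
    have "R / real (n1 * n2 * n3) \<le> 3 * (D + lam * size x0 / \<gamma>) / real (n1 * n2 * n3)"
      unfolding R_def using inner0 s n0 by (intro divide_right_mono mult_right_mono) auto
    also have "\<dots> = 3 * (D / real (n1 * n2 * n3) + lam * size x0 / real m)"
      using n0 m0 by (simp add: \<gamma>_def add_divide_distrib del: of_nat_mult)
    also have "\<dots> \<le> 3 * (D / real (n1 * n2 * n3) + (lam + 8 * \<kappa> * (\<beta> + 2) * LL / 3) * size x0 / real m)"
      using \<kappa>0 \<beta> LL0 size0 m0
      by (intro mult_left_mono add_left_mono divide_right_mono mult_right_mono) auto
    also have "\<dots> \<le> \<dots> + 8 * \<kappa> * ln (real m) / real m"
      using \<kappa>0 m by simp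
    finally show ?thesis .
  qed
  have "enn2ereal (\<integral>\<^sup>+\<omega>. ennreal (\<Sum>t\<in>I. h (e \<omega>) t) \<partial>\<mu>) \<le> ereal R"
    using main R0 by (metis enn2ereal_ennreal less_eq_ennreal.rep_eq)
  then have "enn2ereal (\<integral>\<^sup>+\<omega>. ennreal (\<Sum>t\<in>I. h (e \<omega>) t) \<partial>\<mu>) / ereal (real (n1 * n2 * n3))
      \<le> ereal R / ereal (real (n1 * n2 * n3))"
    using n0 by (intro ereal_divide_right_mono) auto
  also have "\<dots> = ereal (R / real (n1 * n2 * n3))" using n by simp
  also have "\<dots> \<le> ereal (3 * (D / real (n1 * n2 * n3)
      + (lam + 8 * \<kappa> * (\<beta> + 2) * LL / 3) * size x0 / real m) + 8 * \<kappa> * ln (real m) / real m)"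
    using real_bound by simp
  also have "\<dots> = 3 * risk x0 + ereal (8 * \<kappa> * ln (real m) / real m)"
    using n0 by (simp add: risk_def KLt_D numeral_eq_ereal del: of_nat_mult)
  finally have "enn2ereal (\<integral>\<^sup>+\<omega>. ennreal (\<Sum>t\<in>I. h (e \<omega>) t) \<partial>\<mu>) / ereal (real (n1 * n2 * n3))
      \<le> 3 * Min (risk ` G) + ereal (8 * \<kappa> * ln (real m) / real m)"
    by (simp only: Min_x0)
  then show ?thesis
    unfolding I_def[symmetric] G_def[symmetric] integrand PiM_eq \<gamma>_def[symmetric] \<mu>_def[symmetric]
      LL_def[symmetric] risk_def[abs_def] Xf_def size_def .
qed

end
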